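(* Let $h(x)$ be a polynomial with real coefficients and let $F_{h,n}(x)$ be defined by $F_{h,0}=0$, $F_{h,1}=1$, $F_{h,n+1}=h(x)F_{h,n}+F_{h,n-1}$ ($n\ge1$). Fix an integer $l\ge0$ and set $F_{h,n}^l(x)=\sum_{i=0}^{l}\binom{n-1-i}{i}h^{n-2i-1}(x)$ for $n\ge 2l+1$ and $F_{h,n}^l(x)=0$ for $0\le n<2l+1$. Then, as formal power series in $t$, $$\sum_{i=0}^{\infty}F_{h,i}^{l}(x)\,t^{i}=\frac{t^{2l+1}\left[F_{h,2l+1}(x)+\big(F_{h,2l+2}(x)-h(x)F_{h,2l+1}(x)\big)t-\dfrac{t^{2}}{(1-h(x)t)^{l+1}}\right]}{1-h(x)t-t^{2}}.$$
   Context: $h(x)$ is a polynomial with real coefficients. $F_{h,n}$ are the $h(x)$-Fibonacci polynomials and $F^l_{h,n}$ the incomplete $h(x)$-Fibonacci polynomials (extended by $0$ for $n<2l+1$). *)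

theory Defs
  imports "HOL-Computational_Algebra.Computational_Algebra"
begin

fun hfib :: "real poly \<Rightarrow> nat \<Rightarrow> real poly" where
  "hfib h 0 = 0"
| "hfib h (Suc 0) = 1"
| "hfib h (Suc (Suc n)) = h * hfib h (Suc n) + hfib h n"

text \<open>
  In the nonzero case \<open>i \<le> l\<close> and \<open>2 * l + 1 \<le> n\<close>, so neither of the subtractions
  on natural numbers truncates.
\<close>

definition incomplete_hfib :: "real poly \<Rightarrow> nat \<Rightarrow> nat \<Rightarrow> real poly" where
  "incomplete_hfib h l n =
    (if 2 * l + 1 \<le> n
     then (\<Sum>i=0..l. of_nat ((n - 1 - i) choose i) * h ^ (n - 2 * i - 1))
     else 0)"

text \<open>
  Division of formal power series is only available over coefficient types with an inverse, so
  polynomials are regarded, via the injective ring homomorphism \<^const>\<open>to_fract\<close>, as elements of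
  the field of rational functions, and \<open>pconst p\<close> is \<open>p\<close> as a series that is constant
  in the variable \<open>t\<close> (which is \<^const>\<open>fps_X\<close>).
\<close>

abbreviation pconst :: "real poly \<Rightarrow> real poly fract fps" where
  "pconst p \<equiv> fps_const (to_fract p)"

end

theory Submission
  imports Defs
begin

text \<open>
  After division by \<open>t ^ (2 * l + 1)\<close> the coefficients of the series are
  \<open>a\<^sub>n = (\<Sum>i\<le>l. ((n + 2 * l - i) choose i) * h ^ (n + 2 * l - 2 * i))\<close>. Pascal's rule makes the
  Fibonacci recurrence telescope over \<open>i\<close>, leaving only the boundary term:
  \<open>a\<^sub>n\<^sub>+\<^sub>2 - h * a\<^sub>n\<^sub>+\<^sub>1 - a\<^sub>n = - ((n + l) choose l) * h ^ n\<close>. Its generating function is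
  \<open>- 1 / (1 - h * t) ^ (l + 1)\<close>, and the first two coefficients \<open>a\<^sub>0\<close>, \<open>a\<^sub>1\<close> are untruncated
  Fibonacci polynomials.
\<close>

text \<open>
  Where \<open>n - 2 * i\<close> truncates, the binomial coefficient is \<open>0\<close>, so \<open>l\<close> and \<open>n\<close> may be arbitrary.
\<close>

definition hfib_sum :: "real poly \<Rightarrow> nat \<Rightarrow> nat \<Rightarrow> real poly" where
  "hfib_sum h l n = (\<Sum>i\<le>l. of_nat ((n - i) choose i) * h ^ (n - 2 * i))"

lemma hfib_sum_rec:
  "hfib_sum h l (n + 2) + of_nat ((n - l) choose l) * h ^ (n - 2 * l) =
    h * hfib_sum h l (n + 1) + hfib_sum h l n"
proof (induction l)
  case 0
  show ?case by (simp add: hfib_sum_def)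
next
  case (Suc l)
  let ?c = "\<lambda>n i. of_nat ((n - i) choose i) * h ^ (n - 2 * i)"
  \<comment> \<open>Pascal's rule pairs each term at \<open>n + 2\<close> with its predecessor at
    \<open>n\<close>, so the last term at \<open>n\<close> stays unmatched.\<close>
  have "?c (n + 2) (Suc l) = ?c n l + h * ?c (n + 1) (Suc l)"
  proof (cases "2 * l < n")
    case True
    then have "h ^ (n - 2 * l) = h * h ^ (n + 1 - 2 * Suc l)"
      by (simp flip: power_Suc add: Suc_diff_Suc)
    moreover have "n + 2 - Suc l = Suc (n - l)"
      using True by simp
    ultimately show ?thesis
      by (simp add: algebra_simps)
  next
    \<comment> \<open>Here \<open>(n - l) choose Suc l\<close> is 0, so the truncated exponent of
      its term is harmless.\<close>
    case False
    then show ?thesis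
      by (cases "l \<le> n") (simp_all add: Suc_diff_le binomial_eq_0)
  qed
  moreover have "hfib_sum h (Suc l) m = hfib_sum h l m + ?c m (Suc l)" for m
    by (simp add: hfib_sum_def)
  ultimately show ?case
    using Suc.IH by (simp add: algebra_simps)
qed

text \<open>Nonzero terms have 2 * i \<le> n, hence i \<le> l, so nothing is cut off. In the
  induction this shows as the boundary term of \<open>hfib_sum_rec\<close> vanishing.\<close>

lemma hfib_sum_eq_hfib: "n \<le> 2 * l + 1 \<Longrightarrow> hfib_sum h l n = hfib h (Suc n)"
proof (induction n rule: induct_nat_012)
  case 0
  have "hfib_sum h l 0 = (\<Sum>i\<le>l. if i = 0 then 1 else 0)"
    unfolding hfib_sum_def by (intro sum.cong) auto
  then show ?case by simp
next
  case 1
  have "hfib_sum h l 1 = (\<Sum>i\<le>l. if i = 0 then h else 0)"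
    unfolding hfib_sum_def by (intro sum.cong) (auto simp: binomial_eq_0)
  then show ?case by simp
next
  case (ge2 n)
  then have "(n - l) choose l = 0"
    by (intro binomial_eq_0) auto
  with ge2 hfib_sum_rec[of h l n] show ?case
    by simp
qed

lemma incomplete_hfib_eq_hfib_sum:
  "2 * l + 1 \<le> n \<Longrightarrow> incomplete_hfib h l n = hfib_sum h l (n - 1)"
  by (simp add: incomplete_hfib_def hfib_sum_def atMost_atLeast0 diff_commute)

lemma to_fract_of_nat: "to_fract (of_nat n) = of_nat n"
  by (induction n) simp_all

lemma to_fract_power: "to_fract (x ^ n) = to_fract x ^ n"
  by (induction n) simp_all

theorem theorem17:
  fixes h :: "real poly" and l :: nat
  shows "Abs_fps (\<lambda>i. to_fract (incomplete_hfib h l i)) =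
    fps_X ^ (2 * l + 1) *
      (pconst (hfib h (2 * l + 1))
       + (pconst (hfib h (2 * l + 2)) - pconst h * pconst (hfib h (2 * l + 1))) * fps_X
       - fps_X ^ 2 / (1 - pconst h * fps_X) ^ (l + 1))
    / (1 - pconst h * fps_X - fps_X ^ 2)"
proof -
  define a where "a n = hfib_sum h l (n + 2 * l)" for n
  define A where "A = Abs_fps (\<lambda>n. to_fract (a n))"
  define P where "P = Abs_fps (\<lambda>n. of_nat ((n + l) choose l) * to_fract h ^ n)"
  let ?D = "1 - pconst h * fps_X - fps_X ^ 2"
  \<comment> \<open>The numerator with its inner quotient already expanded as \<open>P\<close>, so
    that \<open>?D * A = ?N\<close> can be checked coefficientwise.\<close>
  let ?N = "pconst (hfib h (2 * l + 1))
    + (pconst (hfib h (2 * l + 2)) - pconst h * pconst (hfib h (2 * l + 1))) * fps_X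
    - fps_X ^ 2 * P"
  have choose: "(l + n) choose n = (n + l) choose l" for n
    by (subst binomial_symmetric) (simp_all add: add.commute)
  have "inverse ((1 - pconst h * fps_X) ^ (l + 1)) = P"
    using one_minus_const_fps_X_neg_power'[of "l + 1" "to_fract h"] by (simp add: P_def choose)
  then have P: "fps_X ^ 2 / (1 - pconst h * fps_X) ^ (l + 1) = fps_X ^ 2 * P"
    by (simp add: fps_divide_unit)
  have "to_fract (incomplete_hfib h l n) = (fps_X ^ (2 * l + 1) * A) $ n" for n
  proof (cases "2 * l + 1 \<le> n")
    case True
    then show ?thesis
      by (simp add: incomplete_hfib_eq_hfib_sum fps_X_power_mult_nth A_def a_def
          del: power_Suc)
  next
    case False
    then show ?thesis
      by (simp add: incomplete_hfib_def fps_X_power_mult_nth del: power_Suc)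
  qed
  then have shift: "Abs_fps (\<lambda>i. to_fract (incomplete_hfib h l i)) = fps_X ^ (2 * l + 1) * A"
    by (intro fps_ext) simp
  have rec: "to_fract (a (n + 2)) + of_nat ((n + l) choose l) * to_fract h ^ n =
      to_fract h * to_fract (a (n + 1)) + to_fract (a n)" for n
    using hfib_sum_rec[of h l "n + 2 * l", THEN arg_cong[of _ _ to_fract]]
    by (simp add: a_def to_fract_of_nat to_fract_power ac_simps)
  \<comment> \<open>The indices \<open>2 * l\<close> and \<open>2 * l + 1\<close> are the last at
    which the sum is still complete.\<close>
  have init: "hfib h (2 * l + 1) = a 0" "hfib h (2 * l + 2) = a 1"
    by (simp_all add: a_def hfib_sum_eq_hfib del: hfib.simps)
  have D_nth: "(?D * A) $ n = A $ n - (if n = 0 then 0 else to_fract h * A $ (n - 1))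
      - (if n < 2 then 0 else A $ (n - 2))" for n
    by (simp add: left_diff_distrib mult.assoc fps_X_power_mult_nth)
  have N_nth: "?N $ n = (if n = 0 then to_fract (a 0) else 0)
      + (if n = 1 then to_fract (a 1) - to_fract h * to_fract (a 0) else 0)
      - (if n < 2 then 0 else P $ (n - 2))" for n
    unfolding init by (auto simp: fps_X_power_mult_nth)
  \<comment> \<open>The linear part of \<open>?N\<close> is chosen to fit coefficients 0 and 1; from
    2 on the claim is \<open>rec\<close>.\<close>
  have "(?D * A) $ n = ?N $ n" for n
    unfolding D_nth N_nth
  proof (induction n rule: induct_nat_012)
    case (ge2 n)
    show ?case
      using rec[of n] by (simp add: A_def P_def algebra_simps)
  qed (simp_all add: A_def)
  then have "?D * A = ?N"
    by (rule fps_ext)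
  moreover have "?D $ 0 \<noteq> 0"
    by simp
  then have "?D \<noteq> 0"
    by (metis fps_zero_nth)
  then have "fps_X ^ (2 * l + 1) * A * ?D / ?D = fps_X ^ (2 * l + 1) * A"
    by (rule fps_divide_times_eq)
  ultimately have "fps_X ^ (2 * l + 1) * ?N / ?D = fps_X ^ (2 * l + 1) * A"
    by (simp only: mult.assoc mult.commute[of A])
  then show ?thesis
    unfolding P shift by simp
qed

end
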